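(* The categories of spherically complete ball spaces, of $\mathbf{S}_2$ ball spaces, of $\mathbf{S}_3$ ball spaces and of $\mathbf{S}_4$ ball spaces, all of them with ball continuous functions as their morphisms, admit products and coproducts.
   Context: A ball space is a pair $(X,\mathcal{B})$ where $X$ is a nonempty set and $\mathcal{B}$ is a nonempty set of nonempty subsets of $X$; the elements of $\mathcal{B}$ are called balls. A nest of balls in $\mathcal{B}$ is a nonempty collection $\mathcal{N}$ of balls in $\mathcal{B}$ that is totally ordered by inclusion. The ball space $(X,\mathcal{B})$ is - spherically complete if the intersection $\bigcap\mathcal{N}$ of each nest $\mathcal{N}$ of balls in $\mathcal{B}$ is nonempty; - $\mathbf{S}_2$ if the intersection of each nest contains a ball (as a subset); - $\mathbf{S}_3$ if the intersection of each nest contains a largest ball; - $\mathbf{S}_4$ if the intersection of each nest is a ball. A function $f:X\to X'$ is ball continuous from $(X,\mathcal{B})$ to $(X',\mathcal{B}')$ if $f^{-1}(B')\in\mathcal{B}$ for every $B'\in\mathcal{B}'$. Products and coproducts are meant in the sense of category theory, for ball spaces $(Y_i,\mathcal{B}_i)$, $i\in I$, in the respective category.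
   Formalization: Products and coproducts are taken over nonempty index sets I; for empty I the claim fails, since none of the four categories has a terminal or an initial object. *)

theory Defs
  imports Main "HOL-Library.FuncSet"
begin

record 'a ball_space =
  points :: "'a set"
  balls :: "'a set set"

definition is_ball_space :: "'a ball_space \<Rightarrow> bool" where
  "is_ball_space S \<longleftrightarrow>
     points S \<noteq> {} \<and> balls S \<noteq> {} \<and> (\<forall>B \<in> balls S. B \<noteq> {} \<and> B \<subseteq> points S)"

definition nest :: "'a ball_space \<Rightarrow> 'a set set \<Rightarrow> bool" where
  "nest S N \<longleftrightarrow> N \<noteq> {} \<and> N \<subseteq> balls S \<and> chain\<^sub>\<subseteq> N"

definition spherically_complete :: "'a ball_space \<Rightarrow> bool" where
  "spherically_complete S \<longleftrightarrow> (\<forall>N. nest S N \<longrightarrow> \<Inter>N \<noteq> {})"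

definition S2_space :: "'a ball_space \<Rightarrow> bool" where
  "S2_space S \<longleftrightarrow> (\<forall>N. nest S N \<longrightarrow> (\<exists>B \<in> balls S. B \<subseteq> \<Inter>N))"

definition S3_space :: "'a ball_space \<Rightarrow> bool" where
  "S3_space S \<longleftrightarrow>
     (\<forall>N. nest S N \<longrightarrow>
        (\<exists>B \<in> balls S. B \<subseteq> \<Inter>N \<and> (\<forall>B' \<in> balls S. B' \<subseteq> \<Inter>N \<longrightarrow> B' \<subseteq> B)))"

definition S4_space :: "'a ball_space \<Rightarrow> bool" where
  "S4_space S \<longleftrightarrow> (\<forall>N. nest S N \<longrightarrow> \<Inter>N \<in> balls S)"

text \<open>
  The four categories are named by a datatype, rather than passed around as predicates on ball
  spaces, because one and the same category has to be used at several carrier types at once.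
\<close>

datatype ball_category = SC | S2 | S3 | S4

definition objects :: "ball_category \<Rightarrow> 'a ball_space set" where
  "objects C = {S. is_ball_space S \<and>
     (case C of SC \<Rightarrow> spherically_complete S | S2 \<Rightarrow> S2_space S
              | S3 \<Rightarrow> S3_space S | S4 \<Rightarrow> S4_space S)}"

text \<open>
  Morphisms are extensional functions, so that equality of morphisms is equality in HOL;
  they are composed with \<^const>\<open>compose\<close>.
\<close>

definition ball_hom :: "'a ball_space \<Rightarrow> 'b ball_space \<Rightarrow> ('a \<Rightarrow> 'b) set" where
  "ball_hom S T =
     {f \<in> points S \<rightarrow>\<^sub>E points T. \<forall>B \<in> balls T. f -` B \<inter> points S \<in> balls S}"

lemma ball_hom_id:
  assumes "is_ball_space S"
  shows "restrict id (points S) \<in> ball_hom S S"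
proof -
  have "restrict id (points S) -` B \<inter> points S = B" if "B \<in> balls S" for B
  proof -
    have "B \<subseteq> points S" using assms that by (simp add: is_ball_space_def)
    then show ?thesis by auto
  qed
  then show ?thesis by (auto simp: ball_hom_def)
qed

lemma ball_hom_compose:
  assumes f: "f \<in> ball_hom S T" and g: "g \<in> ball_hom T U"
  shows "compose (points S) g f \<in> ball_hom S U"
proof -
  have "compose (points S) g f -` B \<inter> points S
          = f -` (g -` B \<inter> points T) \<inter> points S" for B
    using f by (auto simp: ball_hom_def compose_def)
  moreover have "compose (points S) g f \<in> points S \<rightarrow>\<^sub>E points U"
    using f g by (auto simp: ball_hom_def compose_def)
  moreover have "f -` (g -` B \<inter> points T) \<inter> points S \<in> balls S" if "B \<in> balls U" for B
    using f g that unfolding ball_hom_def by blast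
  ultimately show ?thesis
    by (simp only: ball_hom_def mem_Collect_eq) blast
qed

text \<open>
  The universal properties below are tested against all objects \<open>Z\<close> with carrier in the type
  \<open>'z\<close>, since HOL cannot quantify over types inside a formula.  If two (co)cones both satisfy the
  universal property for test objects with carrier in their own type, then they are isomorphic.
  Hence demanding this property, in addition to the one for an arbitrary type \<open>'z\<close>, means that a
  single (co)cone satisfies the universal property for test objects of every type.
\<close>

definition is_product ::
  "'z itself \<Rightarrow> ball_category \<Rightarrow> 'i set \<Rightarrow> ('i \<Rightarrow> 'a ball_space) \<Rightarrow>
     'p ball_space \<Rightarrow> ('i \<Rightarrow> 'p \<Rightarrow> 'a) \<Rightarrow> bool" where
  "is_product T C I Y P \<pi> \<longleftrightarrow>
     P \<in> objects C \<and> (\<forall>i\<in>I. \<pi> i \<in> ball_hom P (Y i)) \<and>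
     (\<forall>(Z :: 'z ball_space) f.
        Z \<in> objects C \<longrightarrow> (\<forall>i\<in>I. f i \<in> ball_hom Z (Y i)) \<longrightarrow>
        (\<exists>!h. h \<in> ball_hom Z P \<and> (\<forall>i\<in>I. compose (points Z) (\<pi> i) h = f i)))"

definition is_coproduct ::
  "'z itself \<Rightarrow> ball_category \<Rightarrow> 'i set \<Rightarrow> ('i \<Rightarrow> 'a ball_space) \<Rightarrow>
     'q ball_space \<Rightarrow> ('i \<Rightarrow> 'a \<Rightarrow> 'q) \<Rightarrow> bool" where
  "is_coproduct T C I Y Q \<iota> \<longleftrightarrow>
     Q \<in> objects C \<and> (\<forall>i\<in>I. \<iota> i \<in> ball_hom (Y i) Q) \<and>
     (\<forall>(Z :: 'z ball_space) f.
        Z \<in> objects C \<longrightarrow> (\<forall>i\<in>I. f i \<in> ball_hom (Y i) Z) \<longrightarrow>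
        (\<exists>!h. h \<in> ball_hom Q Z \<and> (\<forall>i\<in>I. compose (points (Y i)) h (\<iota> i) = f i)))"

end

theory Submission
  imports Defs
begin

text \<open>
  The product carries the cylinders over balls of the factors.  A cylinder over a nonempty set in
  one coordinate lies in a cylinder over a set in another coordinate only if the latter set is the
  whole factor, so a nest of cylinders, apart from the whole product, lives in a single coordinate
  and inherits its completeness from there.  The balls of the coproduct are the sets all of whose
  traces on the summands are balls, so that completeness can be checked summand by summand.
\<close>

section \<open>One completeness condition for all four categories\<close>

text \<open>The requirement on nests is turned into a property of a mere set \<open>A\<close>.
  Intersections can then be transferred from the factors or summands for all four categories at
  once.\<close>

definition complete_at :: "ball_category \<Rightarrow> 'a ball_space \<Rightarrow> 'a set \<Rightarrow> bool" where
  "complete_at C S A \<longleftrightarrow>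
     (case C of SC \<Rightarrow> A \<noteq> {}
              | S2 \<Rightarrow> \<exists>B \<in> balls S. B \<subseteq> A
              | S3 \<Rightarrow> \<exists>B \<in> balls S. B \<subseteq> A \<and> (\<forall>B' \<in> balls S. B' \<subseteq> A \<longrightarrow> B' \<subseteq> B)
              | S4 \<Rightarrow> A \<in> balls S)"

lemma objects_iff:
  "S \<in> objects C \<longleftrightarrow> is_ball_space S \<and> (\<forall>N. nest S N \<longrightarrow> complete_at C S (\<Inter>N))"
  by (cases C) (auto simp: objects_def complete_at_def spherically_complete_def
      S2_space_def S3_space_def S4_space_def)

text \<open>A ball is the largest ball contained in itself. This settles the nest whose only member
  is the whole product.\<close>

lemma complete_at_ball:
  assumes "is_ball_space S" "B \<in> balls S"
  shows "complete_at C S B"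
  using assms by (cases C) (auto simp: complete_at_def is_ball_space_def)

text \<open>For empty \<open>I\<close>, the space \<open>product\<close> would have no balls and
  \<open>coproduct\<close> no points.\<close>

locale ball_family =
  fixes C :: ball_category and I :: "'i set" and Y :: "'i \<Rightarrow> 'a ball_space"
  assumes I_nonempty: "I \<noteq> {}"
    and Y_objects: "i \<in> I \<Longrightarrow> Y i \<in> objects C"
begin

lemma Y_ball_space: "i \<in> I \<Longrightarrow> is_ball_space (Y i)"
  using Y_objects by (simp add: objects_iff)

lemma Y_complete_at: "i \<in> I \<Longrightarrow> nest (Y i) N \<Longrightarrow> complete_at C (Y i) (\<Inter>N)"
  using Y_objects by (simp add: objects_iff)

lemma points_nonempty: "i \<in> I \<Longrightarrow> points (Y i) \<noteq> {}"
  using Y_ball_space by (simp add: is_ball_space_def)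

lemma ball_subset: "i \<in> I \<Longrightarrow> B \<in> balls (Y i) \<Longrightarrow> B \<subseteq> points (Y i)"
  using Y_ball_space by (simp add: is_ball_space_def)

lemma ball_nonempty: "i \<in> I \<Longrightarrow> B \<in> balls (Y i) \<Longrightarrow> B \<noteq> {}"
  using Y_ball_space by (simp add: is_ball_space_def)

section \<open>Cylinders in the product\<close>

definition cylinder :: "'i \<Rightarrow> 'a set \<Rightarrow> ('i \<Rightarrow> 'a) set" where
  "cylinder i A = {x \<in> \<Pi>\<^sub>E i\<in>I. points (Y i). x i \<in> A}"

text \<open>The balls are exactly the sets that ball continuity of the projections forces to be
  balls. Unlike in the product topology, no finite intersections are added.\<close>

definition product :: "('i \<Rightarrow> 'a) ball_space" where
  "product = \<lparr>points = \<Pi>\<^sub>E i\<in>I. points (Y i), balls = {cylinder i B | i B. i \<in> I \<and> B \<in> balls (Y i)}\<rparr>"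

definition projection :: "'i \<Rightarrow> ('i \<Rightarrow> 'a) \<Rightarrow> 'a" where
  "projection i = restrict (\<lambda>x. x i) (points product)"

lemma points_product: "points product = (\<Pi>\<^sub>E i\<in>I. points (Y i))"
  by (simp add: product_def)

lemma balls_product: "balls product = {cylinder i B | i B. i \<in> I \<and> B \<in> balls (Y i)}"
  by (simp add: product_def)

text \<open>All factors are nonempty, so the product has a point, and overwriting its coordinate
  \<open>i\<close> by \<open>a\<close> stays inside the product.\<close>

lemma point_with_coordinate:
  assumes "i \<in> I" "a \<in> points (Y i)"
  obtains x where "x \<in> points product" "x i = a"
proof -
  obtain x where "x \<in> (\<Pi>\<^sub>E i\<in>I. points (Y i))"
    using points_nonempty PiE_eq_empty_iff[of I "\<lambda>i. points (Y i)"] by blast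
  then have "x(i := a) \<in> points product"
    using assms by (auto simp: points_product PiE_def extensional_def)
  with that show thesis by fastforce
qed

lemma cylinder_mono: "A \<subseteq> B \<Longrightarrow> cylinder i A \<subseteq> cylinder i B"
  by (auto simp: cylinder_def)

lemma cylinder_subset_same:
  assumes "i \<in> I" "A \<subseteq> points (Y i)" "cylinder i A \<subseteq> cylinder i B"
  shows "A \<subseteq> B"
proof
  fix a assume "a \<in> A"
  then obtain x where "x \<in> points product" "x i = a"
    using assms point_with_coordinate by blast
  with \<open>a \<in> A\<close> assms(3) show "a \<in> B" by (auto simp: cylinder_def points_product)
qed

text \<open>Membership in a cylinder over \<open>i\<close> leaves coordinate \<open>j\<close> free.
  Overwriting that coordinate by any \<open>b\<close> keeps a point in the left cylinder, so the
  inclusion puts \<open>b\<close> into \<open>B\<close>.\<close>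

lemma cylinder_subset_different:
  assumes "i \<in> I" "j \<in> I" "i \<noteq> j" "A \<subseteq> points (Y i)" "A \<noteq> {}"
    and "cylinder i A \<subseteq> cylinder j B"
  shows "points (Y j) \<subseteq> B"
proof
  fix b assume b: "b \<in> points (Y j)"
  from assms obtain a where "a \<in> A" "a \<in> points (Y i)" by blast
  then obtain x where "x \<in> points product" "x i = a"
    using assms point_with_coordinate by blast
  then have "x(j := b) \<in> cylinder i A"
    using \<open>a \<in> A\<close> assms(2,3) b
    by (auto simp: cylinder_def points_product PiE_def extensional_def Pi_iff)
  then show "b \<in> B" using assms(6) by (auto simp: cylinder_def)
qed

lemma cylinder_nonempty:
  assumes "i \<in> I" "A \<subseteq> points (Y i)" "A \<noteq> {}"
  shows "cylinder i A \<noteq> {}"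
  \<comment> \<open>An empty cylinder would lie in the cylinder over the empty set, which forces
    \<open>A\<close> to be empty.\<close>
  using cylinder_subset_same[of i A "{}"] assms by (auto simp: cylinder_def)

section \<open>The product as an object of the category\<close>

lemma product_ball_space: "is_ball_space product"
proof -
  obtain i B where iB: "i \<in> I" "B \<in> balls (Y i)"
    using I_nonempty Y_ball_space by (fastforce simp: is_ball_space_def)
  have "cylinder j B \<subseteq> points product" for j B
    by (auto simp: cylinder_def points_product)
  then have "D \<noteq> {} \<and> D \<subseteq> points product" if "D \<in> balls product" for D
    using that cylinder_nonempty[OF _ ball_subset ball_nonempty] unfolding balls_product by blast
  moreover have "cylinder i B \<in> balls product"
    using iB by (auto simp: balls_product)
  ultimately show ?thesis
    unfolding is_ball_space_def by blast
qed

text \<open>In the case \<^const>\<open>S3\<close>, properness of the base forces every ball below the cylinder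
  to be a cylinder in the same coordinate.\<close>

lemma complete_at_cylinder:
  assumes i: "i \<in> I" and A: "A \<subset> points (Y i)" and complete: "complete_at C (Y i) A"
  shows "complete_at C product (cylinder i A)"
proof (cases C)
  case SC
  then show ?thesis using assms cylinder_nonempty by (simp add: complete_at_def)
next
  case S2
  then obtain B where "B \<in> balls (Y i)" "B \<subseteq> A"
    using complete by (auto simp: complete_at_def)
  then have "cylinder i B \<in> balls product" "cylinder i B \<subseteq> cylinder i A"
    using i cylinder_mono by (auto simp: balls_product)
  with S2 show ?thesis by (auto simp: complete_at_def)
next
  case S3
  then obtain B where B: "B \<in> balls (Y i)" "B \<subseteq> A"
    and largest: "\<And>B'. B' \<in> balls (Y i) \<Longrightarrow> B' \<subseteq> A \<Longrightarrow> B' \<subseteq> B"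
    using complete by (auto simp: complete_at_def)
  have "cylinder i B \<in> balls product" "cylinder i B \<subseteq> cylinder i A"
    using i B cylinder_mono by (auto simp: balls_product)
  moreover have "D \<subseteq> cylinder i B" if D: "D \<in> balls product" "D \<subseteq> cylinder i A" for D
  proof -
    obtain j B' where j: "j \<in> I" "B' \<in> balls (Y j)" and "D = cylinder j B'"
      using D by (auto simp: balls_product)
    then have sub: "cylinder j B' \<subseteq> cylinder i A" using D by simp
    then have "j = i"
      using cylinder_subset_different[OF j(1) i] ball_subset[OF j] ball_nonempty[OF j] A by blast
    then have "B' \<subseteq> B"
      using largest cylinder_subset_same[OF i _ sub[unfolded \<open>j = i\<close>]] ball_subset j by blast
    then show ?thesis using \<open>D = _\<close> \<open>j = i\<close> cylinder_mono by blast
  qed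
  ultimately show ?thesis unfolding complete_at_def S3 ball_category.case by blast
next
  case S4
  then show ?thesis using complete i by (auto simp: complete_at_def balls_product)
qed

lemma product_object: "product \<in> objects C"
  unfolding objects_iff
proof (intro conjI allI impI product_ball_space)
  fix N assume nest: "nest product N"
  then have sub: "N \<subseteq> balls product" and chain: "chain\<^sub>\<subseteq> N" and "N \<noteq> {}"
    by (auto simp: nest_def)
  have le: "D \<subseteq> points product" if "D \<in> N" for D
    using that sub product_ball_space by (auto simp: is_ball_space_def)
  show "complete_at C product (\<Inter>N)"
  \<comment> \<open>The whole product can be a cylinder in several coordinates at once, so it is set
    apart; any other ball determines its coordinate.\<close>
  proof (cases "N \<subseteq> {points product}")
    case True
    then have "N = {points product}" using \<open>N \<noteq> {}\<close> by blast
    then show ?thesis using complete_at_ball[OF product_ball_space] sub by auto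
  next
    case False
    then obtain i B where i: "i \<in> I" "B \<in> balls (Y i)" and iN: "cylinder i B \<in> N"
      and proper: "cylinder i B \<noteq> points product"
      using sub unfolding balls_product by blast
    have B: "B \<subset> points (Y i)"
      using ball_subset[OF i] proper i(1) by (fastforce simp: cylinder_def points_product)
    \<comment> \<open>These bases form the nest to be completed in \<open>Y i\<close>. The whole
      factor may be among them, but the proper member \<open>B\<close> keeps their intersection
      proper, as \<open>complete_at_cylinder\<close> demands.\<close>
    define M where "M = {B' \<in> balls (Y i). cylinder i B' \<in> N}"
    have same: "\<exists>B' \<in> M. D = cylinder i B'" if D: "D \<in> N" "D \<noteq> points product" for D
    proof -
      obtain j B' where j: "j \<in> I" "B' \<in> balls (Y j)" and eq: "D = cylinder j B'"
        using D sub unfolding balls_product by blast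
      have "B' \<subset> points (Y j)"
        using ball_subset[OF j] D eq j(1) by (fastforce simp: cylinder_def points_product)
      moreover have "cylinder j B' \<subseteq> cylinder i B \<or> cylinder i B \<subseteq> cylinder j B'"
        using chain iN D eq by (auto simp: chain_subset_def)
      \<comment> \<open>If \<open>j\<close> differed from \<open>i\<close>, either inclusion would
        make \<open>B\<close> or \<open>B'\<close> a whole factor, although both are proper.\<close>
      ultimately have "j = i"
        using cylinder_subset_different[OF i(1) j(1)] cylinder_subset_different[OF j(1) i(1)]
          ball_subset[OF i] ball_nonempty[OF i] ball_nonempty[OF j] B by blast
      then show ?thesis using j eq D by (auto simp: M_def)
    qed
    have "B \<in> M" using i iN by (simp add: M_def)
    have "chain\<^sub>\<subseteq> M"
      unfolding chain_subset_def
    proof (intro ballI)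
      fix A B' assume "A \<in> M" "B' \<in> M"
      then have "A \<subseteq> points (Y i)" "B' \<subseteq> points (Y i)"
        and "cylinder i A \<subseteq> cylinder i B' \<or> cylinder i B' \<subseteq> cylinder i A"
        using chain ball_subset i by (auto simp: M_def chain_subset_def)
      then show "A \<subseteq> B' \<or> B' \<subseteq> A" using cylinder_subset_same[OF i(1)] by blast
    qed
    then have "nest (Y i) M" using \<open>B \<in> M\<close> by (auto simp: nest_def M_def)
    then have "complete_at C (Y i) (\<Inter>M)" using Y_complete_at i by blast
    moreover have "\<Inter>M \<subset> points (Y i)" using \<open>B \<in> M\<close> B by blast
    ultimately have "complete_at C product (cylinder i (\<Inter>M))"
      using complete_at_cylinder i by blast
    moreover have "\<Inter>N = cylinder i (\<Inter>M)"
    proof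
      show "\<Inter>N \<subseteq> cylinder i (\<Inter>M)"
        using iN by (auto simp: cylinder_def M_def)
      \<comment> \<open>Only the whole product can be a member of \<open>N\<close> without a base in
        \<open>M\<close>, and it contains every cylinder.\<close>
      show "cylinder i (\<Inter>M) \<subseteq> \<Inter>N"
      proof (intro Inter_greatest)
        fix D assume "D \<in> N"
        show "cylinder i (\<Inter>M) \<subseteq> D"
        proof (cases "D = points product")
          case True
          then show ?thesis by (auto simp: cylinder_def points_product)
        next
          case False
          then obtain B' where "B' \<in> M" "D = cylinder i B'" using same \<open>D \<in> N\<close> by blast
          then show ?thesis using cylinder_mono[of "\<Inter>M" B'] by blast
        qed
      qed
    qed
    ultimately show ?thesis by simp
  qed
qed

section \<open>Universal property of the product\<close>

lemma projection_hom:
  assumes "i \<in> I"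
  shows "projection i \<in> ball_hom product (Y i)"
proof -
  have "projection i -` B \<inter> points product = cylinder i B" for B
    by (auto simp: projection_def cylinder_def points_product)
  then show ?thesis
    using assms by (auto simp: ball_hom_def projection_def balls_product points_product)
qed

text \<open>Ball continuity into the product is tested on coordinates: the preimage of the cylinder
  over \<open>B\<close> in coordinate \<open>i\<close> is the preimage of \<open>B\<close> under the
  \<open>i\<close>-th coordinate map.\<close>

lemma product_universal:
  assumes f: "\<And>i. i \<in> I \<Longrightarrow> f i \<in> ball_hom Z (Y i)"
  shows "\<exists>!h. h \<in> ball_hom Z product \<and> (\<forall>i\<in>I. compose (points Z) (projection i) h = f i)"
proof (rule ex1I)
  \<comment> \<open>The tuple map is restricted twice: in \<open>z\<close> to be an extensional
    morphism, in \<open>i\<close> because points of the product are extensional on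
    \<open>I\<close>.\<close>
  let ?h = "\<lambda>z\<in>points Z. \<lambda>i\<in>I. f i z"
  have f_fun: "f i \<in> points Z \<rightarrow>\<^sub>E points (Y i)" if "i \<in> I" for i
    using f[OF that] by (simp add: ball_hom_def)
  have h_fun: "?h \<in> points Z \<rightarrow>\<^sub>E points product"
    using f_fun by (fastforce simp: points_product)
  have "?h -` D \<inter> points Z \<in> balls Z" if D: "D \<in> balls product" for D
  proof -
    obtain i B where i: "i \<in> I" "B \<in> balls (Y i)" "D = cylinder i B"
      using D by (auto simp: balls_product)
    have "?h -` D \<inter> points Z = f i -` B \<inter> points Z"
      using i PiE_mem[OF h_fun] by (auto simp: cylinder_def points_product)
    then show ?thesis using f[OF i(1)] i(2) by (simp add: ball_hom_def)
  qed
  then have "?h \<in> ball_hom Z product" using h_fun by (auto simp: ball_hom_def)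
  moreover have "compose (points Z) (projection i) ?h = f i" if "i \<in> I" for i
  proof (rule extensionalityI[of _ "points Z"])
    show "f i \<in> extensional (points Z)" using f_fun[OF that] by (simp add: PiE_def)
    show "compose (points Z) (projection i) ?h z = f i z" if z: "z \<in> points Z" for z
      using PiE_mem[OF h_fun z] z \<open>i \<in> I\<close> by (simp add: compose_def projection_def)
  qed simp
  ultimately show "?h \<in> ball_hom Z product \<and>
      (\<forall>i\<in>I. compose (points Z) (projection i) ?h = f i)" by blast
  fix h assume h: "h \<in> ball_hom Z product \<and> (\<forall>i\<in>I. compose (points Z) (projection i) h = f i)"
  then have hE: "h \<in> points Z \<rightarrow>\<^sub>E points product" by (simp add: ball_hom_def)
  show "h = ?h"
  proof (rule extensionalityI[of _ "points Z"])
    show "h \<in> extensional (points Z)" using hE by (simp add: PiE_def)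
    fix z assume z: "z \<in> points Z"
    have hz: "h z \<in> points product" using hE z by blast
    show "h z = ?h z"
    proof (rule extensionalityI[of _ I])
      show "h z \<in> extensional I" using hz by (simp add: points_product PiE_def)
      fix i assume i: "i \<in> I"
      have "compose (points Z) (projection i) h z = f i z" using h i by simp
      then show "h z i = ?h z i" using hz z i by (simp add: compose_def projection_def)
    qed (use z in simp)
  qed simp
qed

theorem is_product_product: "is_product TYPE('z) C I Y product projection"
  unfolding is_product_def
  using product_object projection_hom product_universal by blast

section \<open>Construction of the coproduct\<close>

text \<open>The preimage under \<open>Pair i\<close> is the trace on summand \<open>i\<close>. This
  is the largest family of balls making all injections ball continuous. The inclusion excludes pairs
  with an index outside \<open>I\<close>, which none of these traces sees.\<close>

definition coproduct :: "('i \<times> 'a) ball_space" where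
  "coproduct = \<lparr>points = (SIGMA i:I. points (Y i)),
     balls = {B. B \<subseteq> (SIGMA i:I. points (Y i)) \<and> (\<forall>i\<in>I. Pair i -` B \<in> balls (Y i))}\<rparr>"

definition injection :: "'i \<Rightarrow> 'a \<Rightarrow> 'i \<times> 'a" where
  "injection i = restrict (Pair i) (points (Y i))"

lemma points_coproduct: "points coproduct = (SIGMA i:I. points (Y i))"
  by (simp add: coproduct_def)

lemma balls_coproduct:
  "B \<in> balls coproduct \<longleftrightarrow> B \<subseteq> points coproduct \<and> (\<forall>i\<in>I. Pair i -` B \<in> balls (Y i))"
  by (simp add: coproduct_def)

text \<open>Balls of the coproduct amount to independent choices of one ball in every summand;
  witnesses are assembled this way below.\<close>

lemma Sigma_balls:
  assumes "\<And>i. i \<in> I \<Longrightarrow> B i \<in> balls (Y i)"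
  shows "Sigma I B \<in> balls coproduct"
proof -
  have "Pair i -` Sigma I B = B i" if "i \<in> I" for i using that by auto
  moreover have "Sigma I B \<subseteq> points coproduct"
    unfolding points_coproduct using assms ball_subset by (intro Sigma_mono) auto
  ultimately show ?thesis using assms by (simp add: balls_coproduct)
qed

section \<open>The coproduct as an object of the category\<close>

lemma coproduct_ball_space: "is_ball_space coproduct"
proof -
  have "\<forall>i\<in>I. \<exists>B. B \<in> balls (Y i)"
    using Y_ball_space by (auto simp: is_ball_space_def)
  then obtain B where "\<And>i. i \<in> I \<Longrightarrow> B i \<in> balls (Y i)" by metis
  then have "balls coproduct \<noteq> {}" using Sigma_balls by blast
  moreover have "D \<noteq> {} \<and> D \<subseteq> points coproduct" if "D \<in> balls coproduct" for D
  proof -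
    obtain i where "i \<in> I" using I_nonempty by blast
    then have "Pair i -` D \<noteq> {}" using that ball_nonempty by (simp add: balls_coproduct)
    with that show ?thesis by (auto simp: balls_coproduct)
  qed
  ultimately show ?thesis unfolding is_ball_space_def by blast
qed

text \<open>For \<open>S2\<close> and \<open>S3\<close>, witnesses are chosen in each summand and
  glued by \<open>Sigma_balls\<close>. For \<open>SC\<close> a single nonempty trace suffices, and
  \<open>S4\<close> is the definition of the balls.\<close>

lemma complete_at_coproduct:
  assumes A: "A \<subseteq> points coproduct"
    and complete: "\<And>i. i \<in> I \<Longrightarrow> complete_at C (Y i) (Pair i -` A)"
  shows "complete_at C coproduct A"
proof (cases C)
  case SC
  obtain i where "i \<in> I" using I_nonempty by blast
  then show ?thesis using SC complete[of i] by (auto simp: complete_at_def)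
next
  case S2
  then have "\<forall>i\<in>I. \<exists>B. B \<in> balls (Y i) \<and> B \<subseteq> Pair i -` A"
    using complete by (auto simp: complete_at_def)
  then obtain B where B: "\<And>i. i \<in> I \<Longrightarrow> B i \<in> balls (Y i) \<and> B i \<subseteq> Pair i -` A" by metis
  then have "Sigma I B \<in> balls coproduct" "Sigma I B \<subseteq> A" using Sigma_balls by auto
  with S2 show ?thesis by (auto simp: complete_at_def)
next
  case S3
  have "\<forall>i\<in>I. \<exists>B. B \<in> balls (Y i) \<and> B \<subseteq> Pair i -` A \<and>
      (\<forall>B' \<in> balls (Y i). B' \<subseteq> Pair i -` A \<longrightarrow> B' \<subseteq> B)"
    using complete unfolding complete_at_def S3 ball_category.case by blast
  then obtain B where B: "\<And>i. i \<in> I \<Longrightarrow> B i \<in> balls (Y i) \<and> B i \<subseteq> Pair i -` A"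
    and largest: "\<And>i B'. i \<in> I \<Longrightarrow> B' \<in> balls (Y i) \<Longrightarrow> B' \<subseteq> Pair i -` A \<Longrightarrow> B' \<subseteq> B i"
    by metis
  have "Sigma I B \<in> balls coproduct" "Sigma I B \<subseteq> A" using B Sigma_balls by auto
  moreover have "D \<subseteq> Sigma I B" if D: "D \<in> balls coproduct" "D \<subseteq> A" for D
  proof -
    \<comment> \<open>The trace of the competing ball \<open>D\<close> is a ball inside the trace of
      \<open>A\<close>, so maximality of \<open>B i\<close> applies in every summand.\<close>
    have "Pair i -` D \<subseteq> B i" if "i \<in> I" for i
      using largest[OF that, of "Pair i -` D"] D that by (auto simp: balls_coproduct)
    moreover have "D \<subseteq> (SIGMA i:I. points (Y i))"
      using D by (simp add: balls_coproduct points_coproduct)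
    ultimately show ?thesis by blast
  qed
  ultimately show ?thesis unfolding complete_at_def S3 ball_category.case by blast
next
  case S4
  then show ?thesis using assms by (auto simp: complete_at_def balls_coproduct)
qed

lemma coproduct_object: "coproduct \<in> objects C"
  unfolding objects_iff
proof (intro conjI allI impI coproduct_ball_space complete_at_coproduct)
  fix N assume nest: "nest coproduct N"
  then have sub: "N \<subseteq> balls coproduct" and chain: "chain\<^sub>\<subseteq> N" and "N \<noteq> {}"
    by (auto simp: nest_def)
  then show "\<Inter>N \<subseteq> points coproduct"
    unfolding subset_iff[of N] balls_coproduct by blast
  fix i assume i: "i \<in> I"
  \<comment> \<open>Taking traces preserves inclusions and commutes with intersections, so the
    traces of \<open>N\<close> form a nest in \<open>Y i\<close> that meets in the trace of its
    intersection.\<close>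
  have "chain\<^sub>\<subseteq> ((-`) (Pair i) ` N)"
    using chain unfolding chain_subset_def by blast
  moreover have "(-`) (Pair i) ` N \<subseteq> balls (Y i)"
    using sub i by (auto simp: balls_coproduct)
  ultimately have "nest (Y i) ((-`) (Pair i) ` N)"
    using \<open>N \<noteq> {}\<close> by (simp add: nest_def)
  then have "complete_at C (Y i) (\<Inter>((-`) (Pair i) ` N))" using Y_complete_at i by blast
  moreover have "\<Inter>((-`) (Pair i) ` N) = Pair i -` \<Inter>N" by auto
  ultimately show "complete_at C (Y i) (Pair i -` \<Inter>N)" by simp
qed

section \<open>Universal property of the coproduct\<close>

lemma injection_hom:
  assumes i: "i \<in> I"
  shows "injection i \<in> ball_hom (Y i) coproduct"
proof -
  have "injection i -` B \<inter> points (Y i) = Pair i -` B" if "B \<in> balls coproduct" for B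
  proof -
    \<comment> \<open>The trace is a ball of \<open>Y i\<close>, so cutting it down to the domain of
      \<open>injection i\<close> loses nothing.\<close>
    have "Pair i -` B \<subseteq> points (Y i)"
      using that ball_subset[OF i] i by (simp add: balls_coproduct)
    then show ?thesis by (auto simp: injection_def)
  qed
  then show ?thesis
    using i by (auto simp: ball_hom_def injection_def balls_coproduct points_coproduct)
qed

text \<open>The trace on summand \<open>i\<close> of a preimage under the copairing is the preimage
  under \<open>f i\<close>, hence a ball of \<open>Y i\<close>. This is what the balls of the
  coproduct require.\<close>

lemma coproduct_universal:
  assumes f: "\<And>i. i \<in> I \<Longrightarrow> f i \<in> ball_hom (Y i) Z"
  shows "\<exists>!h. h \<in> ball_hom coproduct Z \<and> (\<forall>i\<in>I. compose (points (Y i)) h (injection i) = f i)"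
proof (rule ex1I)
  let ?h = "\<lambda>(i, a)\<in>points coproduct. f i a"
  have f_fun: "f i \<in> points (Y i) \<rightarrow>\<^sub>E points Z" if "i \<in> I" for i
    using f[OF that] by (simp add: ball_hom_def)
  have "?h -` B \<inter> points coproduct \<in> balls coproduct" if "B \<in> balls Z" for B
  proof -
    have "Pair i -` (?h -` B \<inter> points coproduct) = f i -` B \<inter> points (Y i)" if "i \<in> I" for i
      using that by (auto simp: points_coproduct)
    then show ?thesis using f \<open>B \<in> balls Z\<close> by (auto simp: balls_coproduct ball_hom_def)
  qed
  moreover have "?h \<in> points coproduct \<rightarrow>\<^sub>E points Z"
    using f_fun by (fastforce simp: points_coproduct)
  ultimately have "?h \<in> ball_hom coproduct Z" by (simp add: ball_hom_def)
  moreover have "compose (points (Y i)) ?h (injection i) = f i" if "i \<in> I" for i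
  proof (rule extensionalityI[of _ "points (Y i)"])
    show "f i \<in> extensional (points (Y i))" using f_fun[OF that] by (simp add: PiE_def)
  qed (use that in \<open>simp_all add: compose_def injection_def points_coproduct\<close>)
  ultimately show "?h \<in> ball_hom coproduct Z \<and>
      (\<forall>i\<in>I. compose (points (Y i)) ?h (injection i) = f i)" by blast
  fix h assume h: "h \<in> ball_hom coproduct Z \<and>
    (\<forall>i\<in>I. compose (points (Y i)) h (injection i) = f i)"
  show "h = ?h"
  proof (rule extensionalityI[of _ "points coproduct"])
    show "h \<in> extensional (points coproduct)" using h by (simp add: ball_hom_def PiE_def)
    \<comment> \<open>Every point of the coproduct lies in the image of an injection, so
      \<open>h\<close> is determined by its composites.\<close>
    fix q assume "q \<in> points coproduct"
    then obtain i a where q: "q = (i, a)" "i \<in> I" "a \<in> points (Y i)"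
      by (auto simp: points_coproduct)
    have "compose (points (Y i)) h (injection i) a = f i a" using h q by simp
    then show "h q = ?h q"
      using q by (simp add: compose_def injection_def points_coproduct)
  qed simp
qed

theorem is_coproduct_coproduct: "is_coproduct TYPE('z) C I Y coproduct injection"
  unfolding is_coproduct_def
  using coproduct_object injection_hom coproduct_universal by blast

end

section \<open>Existence of products and coproducts\<close>

theorem theorem13:
  fixes C :: ball_category
    and I :: "'i set"
    and Y :: "'i \<Rightarrow> 'a ball_space"
  assumes "I \<noteq> {}"
    and "\<And>i. i \<in> I \<Longrightarrow> Y i \<in> objects C"
  shows "(\<exists>(P :: ('i \<Rightarrow> 'a) ball_space) \<pi>.
            is_product TYPE('i \<Rightarrow> 'a) C I Y P \<pi> \<and> is_product TYPE('z) C I Y P \<pi>) \<and>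
         (\<exists>(Q :: ('i \<times> 'a) ball_space) \<iota>.
            is_coproduct TYPE('i \<times> 'a) C I Y Q \<iota> \<and> is_coproduct TYPE('z) C I Y Q \<iota>)"
proof -
  interpret ball_family C I Y by unfold_locales (use assms in auto)
  \<comment> \<open>Both facts are polymorphic in the carrier type of the test objects, so the same
    witnesses serve both test types.\<close>
  show ?thesis by (intro conjI exI) (rule is_product_product is_coproduct_coproduct)+
qed

end
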